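(* Let $\Omega\subset\mathbb R^N$ be a bounded Lipschitz domain, $s\in(0,1)$, and let $K:H_0^s(\Omega)\to L^2(\Omega)$ be a bounded linear operator. For every $\alpha>0$ and every $y^\delta\in L^2(\Omega)$, the functional $J_\alpha:H_0^s(\Omega)\to\mathbb R$, $$J_\alpha(u)=\frac12\|Ku-y^\delta\|_{L^2(\Omega)}^2+\frac{\alpha}{2}\|u\|_{H_0^s(\Omega)}^2,$$ admits a unique minimizer $u_\alpha^\delta\in H_0^s(\Omega)$.
   Context: All spaces are real. $H_0^s(\Omega)$ is the space of functions $u\in H^s(\mathbb R^N)$ with $u=0$ a.e. in $\mathbb R^N\setminus\Omega$ (also regarded as functions on $\Omega$). It is a Hilbert space with norm $$\|u\|_{H_0^s(\Omega)}^2=\|u\|_{L^2(\Omega)}^2+\frac{C_{N,s}}{2}\iint_{\mathbb R^{2N}}\frac{|u(x)-u(y)|^2}{|x-y|^{N+2s}}\,dx\,dy,$$ where $C_{N,s}>0$ is the standard normalization constant of the integral fractional Laplacian, $C_{N,s}=\frac{4^s s\,\Gamma(N/2+s)}{\pi^{N/2}\Gamma(1-s)}$. *)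

theory Defs
  imports "HOL-Analysis.Analysis"
begin

(* The Lipschitz graph condition is stated in the orthogonal coordinate system whose last
   axis is the unit vector e: a point x has last coordinate x \<bullet> e, and its remaining coordinates
   are those of the projection x - (x \<bullet> e) *\<^sub>R e onto the hyperplane orthogonal to e. *)

definition lipschitz_boundary :: "(real ^ 'n) set \<Rightarrow> bool" where
  "lipschitz_boundary \<Omega> \<longleftrightarrow>
     (\<forall>p \<in> frontier \<Omega>. \<exists>r e L g. r > 0 \<and> norm e = 1 \<and>
        L-lipschitz_on {z. z \<bullet> e = 0} g \<and>
        \<Omega> \<inter> ball p r = {x \<in> ball p r. g (x - (x \<bullet> e) *\<^sub>R e) < x \<bullet> e})"

definition bounded_lipschitz_domain :: "(real ^ 'n) set \<Rightarrow> bool" where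
  "bounded_lipschitz_domain \<Omega> \<longleftrightarrow>
     open \<Omega> \<and> connected \<Omega> \<and> \<Omega> \<noteq> {} \<and> bounded \<Omega> \<and> lipschitz_boundary \<Omega>"

(* Elements of the function spaces below are represented by Lebesgue measurable functions;
   two representatives denote the same element iff they agree almost everywhere. *)

definition L2 :: "(real ^ 'n) set \<Rightarrow> (real ^ 'n \<Rightarrow> real) set" where
  "L2 \<Omega> = {f \<in> borel_measurable (lebesgue_on \<Omega>). integrable (lebesgue_on \<Omega>) (\<lambda>x. (f x)\<^sup>2)}"

definition L2_norm :: "(real ^ 'n) set \<Rightarrow> (real ^ 'n \<Rightarrow> real) \<Rightarrow> real" where
  "L2_norm \<Omega> f = sqrt (LINT x|lebesgue_on \<Omega>. (f x)\<^sup>2)"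

definition gagliardo_integrand :: "real \<Rightarrow> (real ^ 'n \<Rightarrow> real) \<Rightarrow> (real ^ 'n) \<times> (real ^ 'n) \<Rightarrow> real" where
  "gagliardo_integrand s u =
     (\<lambda>(x, y). \<bar>u x - u y\<bar>\<^sup>2 / norm (x - y) powr (real CARD('n) + 2 * s))"

definition Hs :: "real \<Rightarrow> (real ^ 'n \<Rightarrow> real) set" where
  "Hs s = {u \<in> L2 UNIV. integrable (lebesgue \<Otimes>\<^sub>M lebesgue) (gagliardo_integrand s u)}"

definition H0s :: "(real ^ 'n) set \<Rightarrow> real \<Rightarrow> (real ^ 'n \<Rightarrow> real) set" where
  "H0s \<Omega> s = {u \<in> Hs s. AE x in lebesgue. x \<notin> \<Omega> \<longrightarrow> u x = 0}"

definition frac_laplacian_const :: "nat \<Rightarrow> real \<Rightarrow> real" where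
  "frac_laplacian_const N s =
     4 powr s * s * Gamma (real N / 2 + s) / (pi powr (real N / 2) * Gamma (1 - s))"

definition H0s_norm :: "(real ^ 'n) set \<Rightarrow> real \<Rightarrow> (real ^ 'n \<Rightarrow> real) \<Rightarrow> real" where
  "H0s_norm \<Omega> s u =
     sqrt ((L2_norm \<Omega> u)\<^sup>2 +
       frac_laplacian_const CARD('n) s / 2 *
         (LINT z|(lebesgue \<Otimes>\<^sub>M lebesgue). gagliardo_integrand s u z))"

(* K acts on representatives, and linearity is required up to equality a.e. Together with the
   norm bound this makes K respect equality a.e., so K is exactly a bounded linear operator
   between the spaces of equivalence classes. *)

definition bounded_linear_H0s_L2 ::
  "(real ^ 'n) set \<Rightarrow> real \<Rightarrow> ((real ^ 'n \<Rightarrow> real) \<Rightarrow> real ^ 'n \<Rightarrow> real) \<Rightarrow> bool" where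
  "bounded_linear_H0s_L2 \<Omega> s K \<longleftrightarrow>
     (\<forall>u \<in> H0s \<Omega> s. K u \<in> L2 \<Omega>) \<and>
     (\<forall>u \<in> H0s \<Omega> s. \<forall>v \<in> H0s \<Omega> s.
        AE x in lebesgue_on \<Omega>. K (\<lambda>t. u t + v t) x = K u x + K v x) \<and>
     (\<forall>c. \<forall>u \<in> H0s \<Omega> s. AE x in lebesgue_on \<Omega>. K (\<lambda>t. c * u t) x = c * K u x) \<and>
     (\<exists>B. \<forall>u \<in> H0s \<Omega> s. L2_norm \<Omega> (K u) \<le> B * H0s_norm \<Omega> s u)"

definition tikhonov ::
  "(real ^ 'n) set \<Rightarrow> real \<Rightarrow> ((real ^ 'n \<Rightarrow> real) \<Rightarrow> real ^ 'n \<Rightarrow> real) \<Rightarrow> (real ^ 'n \<Rightarrow> real) \<Rightarrow>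
     real \<Rightarrow> (real ^ 'n \<Rightarrow> real) \<Rightarrow> real" where
  "tikhonov \<Omega> s K y\<delta> \<alpha> u =
     1 / 2 * (L2_norm \<Omega> (\<lambda>x. K u x - y\<delta> x))\<^sup>2 + \<alpha> / 2 * (H0s_norm \<Omega> s u)\<^sup>2"

definition is_minimizer_on :: "('b \<Rightarrow> real) \<Rightarrow> 'b set \<Rightarrow> 'b \<Rightarrow> bool" where
  "is_minimizer_on J X u \<longleftrightarrow> u \<in> X \<and> (\<forall>v \<in> X. J u \<le> J v)"

end

theory Submission
  imports Defs
begin

text \<open>The functional is strongly convex: at a midpoint it lies below the mean of its values by at least
  \<alpha>/8 times the squared distance, so a fast minimizing sequence is Cauchy and two minimizers
  coincide. Completeness of the Sobolev space follows by passing to an almost everywhere limit and applying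
  Fatou's lemma to both parts of the norm. Continuity of the functional along the sequence is replaced by
  the inequality |g|^2 <= (1 + t) |f|^2 + (1 + 1/t) |f - g|^2, in which t tends to 0 at the end.\<close>

section \<open>Minimization of strongly convex functionals in the abstract\<close>

text \<open>Here \<open>d\<close> abstracts the squared norm of a difference. It vanishes on
  distinct functions that agree almost everywhere, so uniqueness takes the form
  \<open>d u v \<le> 0\<close>. Completeness is asked only of sequences with rate
  \<open>(1/4) ^ n\<close>, a rate that a suitable minimizing sequence attains.\<close>

lemma strongly_convex_minimizer:
  fixes J :: "'a \<Rightarrow> real" and d :: "'a \<Rightarrow> 'a \<Rightarrow> real"
  assumes "X \<noteq> {}" and nonneg: "\<And>u. u \<in> X \<Longrightarrow> 0 \<le> J u" and c: "0 < c"
    and mid: "\<And>u v. u \<in> X \<Longrightarrow> v \<in> X \<Longrightarrow> \<exists>w\<in>X. J w \<le> (J u + J v) / 2 - c * d u v"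
    and upper: "\<And>u v t. u \<in> X \<Longrightarrow> v \<in> X \<Longrightarrow> 0 < t \<Longrightarrow> J v \<le> (1 + t) * J u + (1 + 1 / t) * (C * d u v)"
    and complete: "\<And>U. range U \<subseteq> X \<Longrightarrow> (\<And>n k. n \<le> k \<Longrightarrow> d (U n) (U k) \<le> (1/4) ^ n)
        \<Longrightarrow> \<exists>u\<in>X. (\<lambda>n. d (U n) u) \<longlonglongrightarrow> 0"
  shows "\<exists>u. is_minimizer_on J X u"
    and "\<And>u v. is_minimizer_on J X u \<Longrightarrow> is_minimizer_on J X v \<Longrightarrow> d u v \<le> 0"
proof -
  define m where "m = Inf (J ` X)"
  have bdd: "bdd_below (J ` X)" using nonneg by (rule bdd_belowI2)
  have m_le: "m \<le> J u" if "u \<in> X" for u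
    unfolding m_def using that bdd by (simp add: cInf_lower)
  \<comment> \<open>The factor \<open>c\<close> cancels the one in \<open>mid\<close>: for
    \<open>n \<le> k\<close> the midpoint value is at least \<open>m\<close>, so
    \<open>c * d (U n) (U k)\<close> is at most the mean of \<open>e n\<close> and
    \<open>e k\<close>, hence at most \<open>e n\<close>.\<close>
  define e where "e n = c * (1/4) ^ n" for n :: nat
  have "\<exists>u\<in>X. J u < m + e n" for n
    using cInf_less_iff[of "J ` X" "m + e n"] bdd \<open>X \<noteq> {}\<close> c by (simp add: m_def e_def)
  then obtain U where U: "U n \<in> X" "J (U n) < m + e n" for n
    by metis
  have "d (U n) (U k) \<le> (1/4) ^ n" if "n \<le> k" for n k
  proof -
    obtain w where w: "w \<in> X" "J w \<le> (J (U n) + J (U k)) / 2 - c * d (U n) (U k)"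
      using mid U(1) by blast
    have "e k \<le> e n"
      using c that unfolding e_def by (intro mult_left_mono power_decreasing) auto
    then have "c * d (U n) (U k) \<le> e n"
      using w m_le[OF w(1)] U(2)[of n] U(2)[of k] by (simp add: field_simps)
    then show ?thesis using c by (simp add: e_def)
  qed
  then obtain u where u: "u \<in> X" "(\<lambda>n. d (U n) u) \<longlonglongrightarrow> 0"
    using complete[of U] U(1) by blast
  \<comment> \<open>While \<open>t\<close> is fixed, \<open>1 + 1 / t\<close> is a constant, so
    letting n tend to infinity removes the distance term. Only afterwards does \<open>t\<close> tend
    to 0.\<close>
  have *: "J u \<le> (1 + t) * m" if "t > 0" for t
  proof (rule LIMSEQ_le_const)
    have "(\<lambda>n. (1/4::real) ^ n) \<longlonglongrightarrow> 0" by (intro LIMSEQ_power_zero) simp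
    with u(2) have "(\<lambda>n. (1 + t) * (m + c * (1/4) ^ n) + (1 + 1 / t) * (C * d (U n) u))
        \<longlonglongrightarrow> (1 + t) * (m + c * 0) + (1 + 1 / t) * (C * 0)"
      by (intro tendsto_intros) simp_all
    then show "(\<lambda>n. (1 + t) * (m + c * (1/4) ^ n) + (1 + 1 / t) * (C * d (U n) u)) \<longlonglongrightarrow> (1 + t) * m"
      by simp
    have "J u \<le> (1 + t) * (m + c * (1/4) ^ n) + (1 + 1 / t) * (C * d (U n) u)" for n
    proof -
      have "(1 + t) * J (U n) \<le> (1 + t) * (m + c * (1/4) ^ n)"
        using U(2)[of n] that by (intro mult_left_mono) (auto simp: e_def)
      then show ?thesis using upper[OF U(1) u(1) that, of n] by linarith
    qed
    then show "\<exists>N. \<forall>n\<ge>N. J u \<le> (1 + t) * (m + c * (1/4) ^ n) + (1 + 1 / t) * (C * d (U n) u)"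
      by blast
  qed
  have "J u \<le> m"
  proof (rule tendsto_lowerbound)
    have "((\<lambda>t. (1 + t) * m) \<longlongrightarrow> (1 + 0) * m) (at_right 0)" by (intro tendsto_intros)
    then show "((\<lambda>t. (1 + t) * m) \<longlongrightarrow> m) (at_right 0)" by simp
    show "\<forall>\<^sub>F t in at_right 0. J u \<le> (1 + t) * m"
      using * by (auto simp: eventually_at_right_less intro: eventually_at_rightI[of 0 1])
  qed simp
  then show "\<exists>u. is_minimizer_on J X u"
    unfolding is_minimizer_on_def using u(1) m_le by force
next
  fix u v assume "is_minimizer_on J X u" "is_minimizer_on J X v"
  then have uv: "u \<in> X" "v \<in> X" "\<And>w. w \<in> X \<Longrightarrow> J u \<le> J w" "\<And>w. w \<in> X \<Longrightarrow> J v \<le> J w"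
    unfolding is_minimizer_on_def by auto
  then obtain w where w: "w \<in> X" "J w \<le> (J u + J v) / 2 - c * d u v" using mid by blast
  \<comment> \<open>Both minimal values are at most \<open>J w\<close>, hence so is their mean;
    nothing is left to compensate a positive \<open>c * d u v\<close>.\<close>
  then have "c * d u v \<le> 0" using w(2) uv(3,4)[OF w(1)] by (simp add: field_simps)
  then show "d u v \<le> 0" using c by (simp add: mult_le_0_iff)
qed

section \<open>Square-integrable functions over a general measure\<close>

text \<open>The measure is a parameter because the same facts are applied on
  \<open>\<Omega>\<close>, on the whole space and on the product space of the Gagliardo
  seminorm.\<close>

definition sq_integrable :: "'a measure \<Rightarrow> ('a \<Rightarrow> real) \<Rightarrow> bool" where
  "sq_integrable M f \<longleftrightarrow> f \<in> borel_measurable M \<and> integrable M (\<lambda>x. (f x)\<^sup>2)"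

lemma sq_integrable_lincomb:
  assumes "sq_integrable M f" "sq_integrable M g"
  shows "sq_integrable M (\<lambda>x. a * f x + b * g x)"
proof -
  have [measurable]: "f \<in> borel_measurable M" "g \<in> borel_measurable M"
    using assms by (auto simp: sq_integrable_def)
  have "integrable M (\<lambda>x. 2 * a\<^sup>2 * (f x)\<^sup>2 + 2 * b\<^sup>2 * (g x)\<^sup>2)"
    using assms by (auto simp: sq_integrable_def)
  then have "integrable M (\<lambda>x. (a * f x + b * g x)\<^sup>2)"
  proof (rule Bochner_Integration.integrable_bound)
    have "(p + q)\<^sup>2 \<le> 2 * p\<^sup>2 + 2 * q\<^sup>2" for p q :: real
      using zero_le_power2[of "p - q"] by (simp add: power2_eq_square algebra_simps)
    from this[of "a * f x" "b * g x" for x]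
    show "AE x in M. norm ((a * f x + b * g x)\<^sup>2) \<le> norm (2 * a\<^sup>2 * (f x)\<^sup>2 + 2 * b\<^sup>2 * (g x)\<^sup>2)"
      by (auto simp: power_mult_distrib mult.assoc)
  qed measurable
  then show ?thesis by (simp add: sq_integrable_def)
qed

lemma sq_integrable_diff:
  assumes "sq_integrable M f" "sq_integrable M g"
  shows "sq_integrable M (\<lambda>x. f x - g x)"
  using sq_integrable_lincomb[OF assms, of 1 "- 1"] by simp

text \<open>The parallelogram identity, integrated. The subtracted term is the source of strong
  convexity.\<close>

lemma integral_square_midpoint:
  assumes "sq_integrable M f" "sq_integrable M g"
  shows "(LINT x|M. ((f x + g x) / 2)\<^sup>2) =
    ((LINT x|M. (f x)\<^sup>2) + (LINT x|M. (g x)\<^sup>2)) / 2 - (LINT x|M. (f x - g x)\<^sup>2) / 4"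
proof -
  have "(LINT x|M. ((f x + g x) / 2)\<^sup>2) = (LINT x|M. ((f x)\<^sup>2 + (g x)\<^sup>2) / 2 - (f x - g x)\<^sup>2 / 4)"
    by (intro Bochner_Integration.integral_cong) (auto simp: power2_eq_square field_simps)
  then show ?thesis
    using assms sq_integrable_diff[OF assms] by (simp add: sq_integrable_def)
qed

text \<open>Young's inequality applied to the cross term in the square of
  \<open>f - (f - g)\<close>. It serves as a quantitative continuity statement for the squared
  norm.\<close>

lemma integral_square_le_weighted:
  assumes f: "sq_integrable M f" and g: "sq_integrable M g" and t: "0 < t"
  shows "(LINT x|M. (g x)\<^sup>2) \<le> (1 + t) * (LINT x|M. (f x)\<^sup>2) + (1 + 1 / t) * (LINT x|M. (f x - g x)\<^sup>2)"
proof -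
  have "q\<^sup>2 \<le> (1 + t) * p\<^sup>2 + (1 + 1 / t) * (p - q)\<^sup>2" for p q :: real
  proof -
    \<comment> \<open>Completing the square: with \<open>q = p - (p - q)\<close> the difference of
      the two sides is \<open>t * p\<^sup>2 + 2 * p * (p - q) + (p - q)\<^sup>2 / t\<close>.\<close>
    have "(1 + t) * p\<^sup>2 + (1 + 1 / t) * (p - q)\<^sup>2 - q\<^sup>2 = (t * p + (p - q))\<^sup>2 / t"
      using t by (simp add: power2_eq_square field_simps)
    also have "\<dots> \<ge> 0" using t by simp
    finally show ?thesis by simp
  qed
  then have "(LINT x|M. (g x)\<^sup>2) \<le> (LINT x|M. (1 + t) * (f x)\<^sup>2 + (1 + 1 / t) * (f x - g x)\<^sup>2)"
    using assms sq_integrable_diff[OF f g]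
    by (intro integral_mono) (auto simp: sq_integrable_def)
  then show ?thesis
    using assms sq_integrable_diff[OF f g] by (simp add: sq_integrable_def)
qed

text \<open>Fatou's lemma for squares gives both integrability of the limit and its bound. The bound
  on \<open>F k\<close> is eventual in \<open>k\<close> to match a Cauchy estimate that holds for
  \<open>n \<le> k\<close>.\<close>

lemma integral_square_Fatou:
  assumes F: "\<And>k. sq_integrable M (F k)" and f [measurable]: "f \<in> borel_measurable M"
    and lim: "AE x in M. (\<lambda>k. F k x) \<longlonglongrightarrow> f x"
    and bound: "\<forall>\<^sub>F k in sequentially. (LINT x|M. (F k x)\<^sup>2) \<le> B"
  shows "sq_integrable M f" and "(LINT x|M. (f x)\<^sup>2) \<le> B"
proof -
  have [measurable]: "F k \<in> borel_measurable M" for k using F by (auto simp: sq_integrable_def)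
  \<comment> \<open>Nonnegativity of \<open>B\<close> is what allows the last step to return from
    \<open>ennreal\<close> to the reals, as \<open>ennreal\<close> sends negative numbers to
    0.\<close>
  obtain k where "(LINT x|M. (F k x)\<^sup>2) \<le> B" using bound by (auto simp: eventually_sequentially)
  moreover have "0 \<le> (LINT x|M. (F k x)\<^sup>2)" by simp
  ultimately have B: "0 \<le> B" by linarith
  have "(\<integral>\<^sup>+x. ennreal ((f x)\<^sup>2) \<partial>M) = (\<integral>\<^sup>+x. liminf (\<lambda>k. ennreal ((F k x)\<^sup>2)) \<partial>M)"
  proof (rule nn_integral_cong_AE)
    from lim show "AE x in M. ennreal ((f x)\<^sup>2) = liminf (\<lambda>k. ennreal ((F k x)\<^sup>2))"
    proof eventually_elim
      case (elim x)
      then have "(\<lambda>k. ennreal ((F k x)\<^sup>2)) \<longlonglongrightarrow> ennreal ((f x)\<^sup>2)" by (intro tendsto_intros)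
      then show ?case by (intro lim_imp_Liminf[symmetric]) simp_all
    qed
  qed
  also have "\<dots> \<le> liminf (\<lambda>k. \<integral>\<^sup>+x. ennreal ((F k x)\<^sup>2) \<partial>M)"
    by (intro nn_integral_liminf) measurable
  also have "\<dots> \<le> ennreal B"
  proof -
    have "(\<integral>\<^sup>+x. ennreal ((F k x)\<^sup>2) \<partial>M) = ennreal (LINT x|M. (F k x)\<^sup>2)" for k
      using F by (intro nn_integral_eq_integral) (auto simp: sq_integrable_def)
    then have "\<forall>\<^sub>F k in sequentially. (\<integral>\<^sup>+x. ennreal ((F k x)\<^sup>2) \<partial>M) \<le> ennreal B"
      using bound by (auto elim!: eventually_mono intro: ennreal_leI)
    then have "liminf (\<lambda>k. \<integral>\<^sup>+x. ennreal ((F k x)\<^sup>2) \<partial>M) \<le> liminf (\<lambda>k::nat. ennreal B)"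
      by (rule Liminf_mono)
    then show ?thesis by (simp add: Liminf_const)
  qed
  finally have le: "(\<integral>\<^sup>+x. ennreal ((f x)\<^sup>2) \<partial>M) \<le> ennreal B" .
  then have int: "integrable M (\<lambda>x. (f x)\<^sup>2)"
    by (intro integrableI_nonneg) (auto simp: less_top[symmetric] top_unique)
  then show "sq_integrable M f" by (simp add: sq_integrable_def)
  have "ennreal (LINT x|M. (f x)\<^sup>2) \<le> ennreal B"
    using le nn_integral_eq_integral[OF int] by simp
  then show "(LINT x|M. (f x)\<^sup>2) \<le> B" using B by simp
qed

text \<open>The weight \<open>2 ^ n\<close> balances two demands: the weighted squares still have
  integrals at most \<open>(1/2) ^ n\<close>, so their series is finite almost everywhere, and the
  increments are bounded by \<open>(1/2) ^ n\<close> plus the weighted squares. Increments are thus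
  absolutely summable, and the whole sequence converges by telescoping.\<close>

lemma AE_convergent_of_summable_L2:
  assumes F: "\<And>n. sq_integrable M (F n)"
    and bound: "\<And>n. (LINT x|M. (F n x - F (Suc n) x)\<^sup>2) \<le> (1/4) ^ n"
  shows "AE x in M. convergent (\<lambda>n. F n x)"
proof -
  have [measurable]: "F k \<in> borel_measurable M" for k using F by (auto simp: sq_integrable_def)
  let ?g = "\<lambda>n x. 2 ^ n * (F n x - F (Suc n) x)\<^sup>2"
  have int: "integrable M (?g n)" for n
    using sq_integrable_diff[OF F F, of n "Suc n"] by (simp add: sq_integrable_def)
  have "(\<integral>\<^sup>+x. ennreal (?g n x) \<partial>M) \<le> ennreal ((1/2) ^ n)" for n
  proof -
    have "(LINT x|M. ?g n x) \<le> 2 ^ n * (1/4) ^ n" using bound[of n] by simp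
    also have "\<dots> = (1/2) ^ n" by (simp flip: power_mult_distrib)
    finally have "(LINT x|M. ?g n x) \<le> (1/2) ^ n" .
    then show ?thesis using nn_integral_eq_integral[OF int, of n] by (simp add: ennreal_leI)
  qed
  then have "(\<Sum>n. \<integral>\<^sup>+x. ennreal (?g n x) \<partial>M) \<le> (\<Sum>n. ennreal ((1/2) ^ n))"
    by (intro suminf_le) auto
  also have "\<dots> < \<infinity>"
    by (subst suminf_ennreal2) (auto intro: summable_geometric)
  finally have "(\<integral>\<^sup>+x. (\<Sum>n. ennreal (?g n x)) \<partial>M) \<noteq> \<infinity>"
    by (subst nn_integral_suminf) auto
  then have "AE x in M. (\<Sum>n. ennreal (?g n x)) \<noteq> \<infinity>"
    by (intro nn_integral_PInf_AE) auto
  then show ?thesis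
  proof eventually_elim
    case (elim x)
    then have "summable (\<lambda>n. ?g n x)"
      by (intro summable_suminf_not_top) auto
    then have "summable (\<lambda>n. (1/2) ^ n + ?g n x)"
      by (intro summable_add) (auto intro: summable_geometric)
    then have "summable (\<lambda>n. F (Suc n) x - F n x)"
    proof (rule summable_comparison_test'[where N = 0])
      \<comment> \<open>AM-GM avoids Cauchy-Schwarz, which would require finite measure.\<close>
      fix n :: nat
      have "\<bar>a\<bar> \<le> 1 / p + p * a\<^sup>2" if "p > 0" for a p :: real
      proof -
        have "0 \<le> (p * \<bar>a\<bar> - 1)\<^sup>2 + p * \<bar>a\<bar> + 0" using that by simp
        then have "p * \<bar>a\<bar> \<le> 1 + p * (p * a\<^sup>2)"
          by (simp add: power2_eq_square algebra_simps flip: abs_mult)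
        then show ?thesis using that by (simp add: field_simps)
      qed
      from this[of "2 ^ n" "F (Suc n) x - F n x"]
      show "norm (F (Suc n) x - F n x) \<le> (1/2) ^ n + ?g n x"
        by (simp add: power_one_over power2_commute)
    qed
    then have "convergent (\<lambda>n. F n x - F 0 x)"
      unfolding summable_iff_convergent sum_lessThan_telescope[of "\<lambda>n. F n x"] .
    then show ?case by (simp add: convergent_diff_const_right_iff)
  qed
qed

section \<open>Null sets of the product measure, and the fractional Sobolev space\<close>

lemma sigma_finite_lebesgue: "sigma_finite_measure (lebesgue :: 'a::euclidean_space measure)"
proof
  have "emeasure lebesgue (cball (0::'a) r) \<noteq> \<infinity>" for r
    using emeasure_bounded_finite[of "cball (0::'a) r"] by (simp add: main_part_sets)
  then show "\<exists>A::'a set set. countable A \<and> A \<subseteq> sets lebesgue \<and> \<Union>A = space lebesgue \<and>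
      (\<forall>a\<in>A. emeasure lebesgue a \<noteq> \<infinity>)"
    by (intro exI[of _ "range (\<lambda>n::nat. cball 0 (real n))"])
      (auto simp: real_arch_simple simp del: emeasure_completion)
qed

text \<open>If \<open>N\<close> contains the exceptional points, the exceptional pairs lie in
  \<open>N \<times> UNIV \<union> UNIV \<times> N\<close>, which is null by sigma-finiteness. This
  carries pointwise convergence of functions over to their slopes.\<close>

lemma AE_lebesgue_pair:
  assumes "AE x in (lebesgue :: 'a::euclidean_space measure). P x"
  shows "AE z in (lebesgue :: 'a measure) \<Otimes>\<^sub>M (lebesgue :: 'a measure). P (fst z) \<and> P (snd z)"
proof -
  interpret sigma_finite_measure "lebesgue :: 'a measure" by (rule sigma_finite_lebesgue)
  obtain N where N: "N \<in> null_sets lebesgue" "{x. \<not> P x} \<subseteq> N"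
    using assms by (auto simp: eventually_ae_filter)
  have "N \<times> UNIV \<union> UNIV \<times> N \<in> null_sets ((lebesgue :: 'a measure) \<Otimes>\<^sub>M (lebesgue :: 'a measure))"
    using N(1) by (intro null_sets.Un times_in_null_sets1 times_in_null_sets2) auto
  then show ?thesis by (rule AE_I') (use N(2) in auto)
qed

text \<open>The Gagliardo integrand of u is the square of the following function, which is linear in u.\<close>

definition slope :: "real \<Rightarrow> (real ^ 'n \<Rightarrow> real) \<Rightarrow> (real ^ 'n) \<times> (real ^ 'n) \<Rightarrow> real" where
  "slope s u z = (u (fst z) - u (snd z)) / norm (fst z - snd z) powr ((real CARD('n) + 2 * s) / 2)"

lemma gagliardo_integrand_eq_slope: "gagliardo_integrand s u z = (slope s u z)\<^sup>2"
  by (cases z) (simp add: gagliardo_integrand_def slope_def power_divide power2_eq_square flip: powr_add)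

lemma slope_lincomb: "slope s (\<lambda>x. a * u x + b * v x) z = a * slope s u z + b * slope s v z"
  by (simp add: slope_def add_divide_distrib diff_divide_distrib algebra_simps)

lemma slope_measurable:
  fixes u :: "real ^ 'n \<Rightarrow> real"
  assumes [measurable]: "u \<in> borel_measurable lebesgue"
  shows "slope s u \<in> borel_measurable (lebesgue \<Otimes>\<^sub>M lebesgue)"
proof -
  \<comment> \<open>The denominator of \<open>slope\<close> needs the coordinates as Borel functions
    on the product of the completed measures; the identity is one because every Borel set is
    Lebesgue measurable.\<close>
  have [measurable]: "(\<lambda>x::real ^ 'n. x) \<in> borel_measurable lebesgue"
    by (rule measurable_completion) simp
  have [measurable]: "(fst :: (real ^ 'n) \<times> (real ^ 'n) \<Rightarrow> _) \<in> borel_measurable (lebesgue \<Otimes>\<^sub>M lebesgue)"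
    using measurable_compose[OF measurable_fst \<open>(\<lambda>x. x) \<in> borel_measurable lebesgue\<close>] by simp
  have [measurable]: "(snd :: (real ^ 'n) \<times> (real ^ 'n) \<Rightarrow> _) \<in> borel_measurable (lebesgue \<Otimes>\<^sub>M lebesgue)"
    using measurable_compose[OF measurable_snd \<open>(\<lambda>x. x) \<in> borel_measurable lebesgue\<close>] by simp
  have "(\<lambda>z. u (fst z)) \<in> borel_measurable (lebesgue \<Otimes>\<^sub>M lebesgue)"
    "(\<lambda>z. u (snd z)) \<in> borel_measurable (lebesgue \<Otimes>\<^sub>M lebesgue)"
    by (auto intro: measurable_compose[OF measurable_fst] measurable_compose[OF measurable_snd])
  note [measurable] = this
  show ?thesis unfolding slope_def[abs_def] by measurable
qed

text \<open>Membership is reduced to square integrability of \<open>u\<close> and of its slope, so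
  that every fact about \<open>sq_integrable\<close> applies to both parts of the norm.\<close>

lemma H0s_iff:
  "u \<in> H0s \<Omega> s \<longleftrightarrow> sq_integrable lebesgue u \<and> sq_integrable (lebesgue \<Otimes>\<^sub>M lebesgue) (slope s u) \<and>
    (AE x in lebesgue. x \<notin> \<Omega> \<longrightarrow> u x = 0)"
  by (auto simp: H0s_def Hs_def L2_def sq_integrable_def gagliardo_integrand_eq_slope[abs_def]
      lebesgue_on_UNIV_eq slope_measurable)

lemma H0s_lincomb:
  assumes "u \<in> H0s \<Omega> s" "v \<in> H0s \<Omega> s"
  shows "(\<lambda>x. a * u x + b * v x) \<in> H0s \<Omega> s"
proof -
  have "AE x in lebesgue. x \<notin> \<Omega> \<longrightarrow> u x = 0" "AE x in lebesgue. x \<notin> \<Omega> \<longrightarrow> v x = 0"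
    using assms by (auto simp: H0s_iff)
  then have "AE x in lebesgue. x \<notin> \<Omega> \<longrightarrow> a * u x + b * v x = 0"
    by eventually_elim simp
  then show ?thesis
    using assms by (auto simp: H0s_iff slope_lincomb[abs_def] intro!: sq_integrable_lincomb)
qed

lemma H0s_diff:
  assumes "u \<in> H0s \<Omega> s" "v \<in> H0s \<Omega> s"
  shows "(\<lambda>x. u x - v x) \<in> H0s \<Omega> s"
  using H0s_lincomb[OF assms, of 1 "- 1"] by simp

lemma slope_diff: "slope s (\<lambda>x. u x - v x) z = slope s u z - slope s v z"
  using slope_lincomb[of s 1 u "- 1" v] by simp

lemma frac_laplacian_const_pos: "0 < s \<Longrightarrow> s < 1 \<Longrightarrow> 0 < frac_laplacian_const N s"
  by (auto simp: frac_laplacian_const_def intro!: divide_pos_pos mult_pos_pos Gamma_real_pos)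

lemma L2_iff: "f \<in> L2 \<Omega> \<longleftrightarrow> sq_integrable (lebesgue_on \<Omega>) f"
  by (simp add: L2_def sq_integrable_def)

lemma L2_norm_square: "(L2_norm \<Omega> f)\<^sup>2 = (LINT x|lebesgue_on \<Omega>. (f x)\<^sup>2)"
  by (simp add: L2_norm_def)

text \<open>Since \<open>u\<close> vanishes almost everywhere outside \<open>\<Omega>\<close>, its
  integral over \<open>\<Omega>\<close> extends to the whole space. The constant is positive, so the
  radicand is nonnegative and squaring undoes the root.\<close>

lemma H0s_norm_square:
  fixes \<Omega> :: "(real ^ 'n) set"
  assumes "\<Omega> \<in> sets lebesgue" "0 < s" "s < 1" "u \<in> H0s \<Omega> s"
  shows "(H0s_norm \<Omega> s u)\<^sup>2 = (LINT x|lebesgue. (u x)\<^sup>2) +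
    frac_laplacian_const CARD('n) s / 2 * (LINT z|(lebesgue \<Otimes>\<^sub>M lebesgue). (slope s u z)\<^sup>2)"
proof -
  have u: "sq_integrable lebesgue u" "AE x in lebesgue. x \<notin> \<Omega> \<longrightarrow> u x = 0"
    using assms(4) by (auto simp: H0s_iff)
  then have [measurable]: "u \<in> borel_measurable lebesgue" by (simp add: sq_integrable_def)
  have "(LINT x|lebesgue_on \<Omega>. (u x)\<^sup>2) = (LINT x|lebesgue. indicator \<Omega> x *\<^sub>R (u x)\<^sup>2)"
    using assms(1) by (intro integral_restrict_space) simp
  also have "\<dots> = (LINT x|lebesgue. (u x)\<^sup>2)"
  proof (rule integral_cong_AE)
    show "(\<lambda>x. indicator \<Omega> x *\<^sub>R (u x)\<^sup>2) \<in> borel_measurable lebesgue"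
      using assms(1) by measurable
    show "AE x in lebesgue. indicator \<Omega> x *\<^sub>R (u x)\<^sup>2 = (u x)\<^sup>2"
      using u(2) by eventually_elim (auto simp: indicator_def)
  qed measurable
  finally have L2: "(L2_norm \<Omega> u)\<^sup>2 = (LINT x|lebesgue. (u x)\<^sup>2)" by (simp add: L2_norm_square)
  show ?thesis
    using frac_laplacian_const_pos[OF assms(2,3), of "CARD('n)"]
    by (simp add: H0s_norm_def L2 gagliardo_integrand_eq_slope)
qed

section \<open>Completeness of the fractional Sobolev space\<close>

text \<open>One pointwise limit serves both parts of the norm: where \<open>U n\<close> converges at
  both coordinates, the slopes converge to the slope of the limit. Fatou's lemma in the second index
  then bounds the distance to the limit.\<close>

lemma H0s_complete:
  fixes \<Omega> :: "(real ^ 'n) set"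
  assumes \<Omega>: "\<Omega> \<in> sets lebesgue" and s: "0 < s" "s < 1" and U: "\<And>n. U n \<in> H0s \<Omega> s"
    and Cauchy: "\<And>n k. n \<le> k \<Longrightarrow> (H0s_norm \<Omega> s (\<lambda>x. U n x - U k x))\<^sup>2 \<le> (1/4) ^ n"
  shows "\<exists>u\<in>H0s \<Omega> s. (\<lambda>n. (H0s_norm \<Omega> s (\<lambda>x. U n x - u x))\<^sup>2) \<longlonglongrightarrow> 0"
proof -
  let ?P = "(lebesgue :: (real ^ 'n) measure) \<Otimes>\<^sub>M (lebesgue :: (real ^ 'n) measure)"
  define c where "c = frac_laplacian_const CARD('n) s / 2"
  have c: "0 < c" using frac_laplacian_const_pos[OF s] by (simp add: c_def)
  note norm_eq = H0s_norm_square[OF \<Omega> s, folded c_def]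
  have sq: "sq_integrable lebesgue (U n)" "sq_integrable ?P (slope s (U n))" for n
    using U by (auto simp: H0s_iff)
  then have [measurable]: "U n \<in> borel_measurable lebesgue" for n by (simp add: sq_integrable_def)
  have le: "(LINT x|lebesgue. (U n x - U k x)\<^sup>2) \<le> (1/4) ^ n"
    "(LINT z|?P. (slope s (U n) z - slope s (U k) z)\<^sup>2) \<le> (1/4) ^ n / c" if "n \<le> k" for n k
  proof -
    have *: "(LINT x|lebesgue. (U n x - U k x)\<^sup>2) +
        c * (LINT z|?P. (slope s (U n) z - slope s (U k) z)\<^sup>2) \<le> (1/4) ^ n"
      using Cauchy[OF that] norm_eq[OF H0s_diff[OF U U], of n k] by (simp add: slope_diff)
    moreover have "0 \<le> (LINT x|lebesgue. (U n x - U k x)\<^sup>2)"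
      "0 \<le> c * (LINT z|?P. (slope s (U n) z - slope s (U k) z)\<^sup>2)"
      using c by (auto intro!: mult_nonneg_nonneg integral_nonneg_AE)
    ultimately have "(LINT x|lebesgue. (U n x - U k x)\<^sup>2) \<le> (1/4) ^ n"
      "c * (LINT z|?P. (slope s (U n) z - slope s (U k) z)\<^sup>2) \<le> (1/4) ^ n"
      by linarith+
    then show "(LINT x|lebesgue. (U n x - U k x)\<^sup>2) \<le> (1/4) ^ n"
      "(LINT z|?P. (slope s (U n) z - slope s (U k) z)\<^sup>2) \<le> (1/4) ^ n / c"
      using c by (simp_all add: pos_le_divide_eq mult.commute)
  qed
  \<comment> \<open>\<open>lim\<close> is total, so \<open>u\<close> is measurable everywhere; its
    values at points of divergence affect only a null set.\<close>
  define u where "u x = lim (\<lambda>n. U n x)" for x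
  have [measurable]: "u \<in> borel_measurable lebesgue" unfolding u_def[abs_def] by measurable
  have "AE x in lebesgue. convergent (\<lambda>n. U n x)"
    using sq(1) le(1) by (intro AE_convergent_of_summable_L2) auto
  then have lim: "AE x in lebesgue. (\<lambda>n. U n x) \<longlonglongrightarrow> u x"
    by eventually_elim (simp add: u_def convergent_LIMSEQ_iff)
  have diff: "sq_integrable lebesgue (\<lambda>x. U n x - u x)"
    "(LINT x|lebesgue. (U n x - u x)\<^sup>2) \<le> (1/4) ^ n" for n
  proof -
    have F: "sq_integrable lebesgue (\<lambda>x. U n x - U k x)" for k
      using sq(1) by (intro sq_integrable_diff)
    have L: "AE x in lebesgue. (\<lambda>k. U n x - U k x) \<longlonglongrightarrow> U n x - u x"
      using lim by eventually_elim (intro tendsto_intros)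
    have B: "\<forall>\<^sub>F k in sequentially. (LINT x|lebesgue. (U n x - U k x)\<^sup>2) \<le> (1/4) ^ n"
      using le(1) by (auto simp: eventually_sequentially)
    show "sq_integrable lebesgue (\<lambda>x. U n x - u x)"
      "(LINT x|lebesgue. (U n x - u x)\<^sup>2) \<le> (1/4) ^ n"
      by (rule integral_square_Fatou[OF F _ L B]; measurable)+
  qed
  \<comment> \<open>Written as multiplication by an inverse, the denominator is a constant factor,
    so the limit also holds on the diagonal, where it is 0.\<close>
  have slope_lim: "AE z in ?P. (\<lambda>n. slope s (U n) z) \<longlonglongrightarrow> slope s u z"
    using AE_lebesgue_pair[OF lim] unfolding slope_def divide_inverse
    by eventually_elim (intro tendsto_mult[OF _ tendsto_const] tendsto_diff; simp)
  have slope_u: "slope s u \<in> borel_measurable ?P" by (rule slope_measurable) measurable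
  have slope_diff': "sq_integrable ?P (\<lambda>z. slope s (U n) z - slope s u z)"
    "(LINT z|?P. (slope s (U n) z - slope s u z)\<^sup>2) \<le> (1/4) ^ n / c" for n
  proof -
    have F: "sq_integrable ?P (\<lambda>z. slope s (U n) z - slope s (U k) z)" for k
      using sq(2) by (intro sq_integrable_diff)
    have L: "AE z in ?P. (\<lambda>k. slope s (U n) z - slope s (U k) z) \<longlonglongrightarrow> slope s (U n) z - slope s u z"
      using slope_lim by eventually_elim (intro tendsto_intros)
    have B: "\<forall>\<^sub>F k in sequentially. (LINT z|?P. (slope s (U n) z - slope s (U k) z)\<^sup>2) \<le> (1/4) ^ n / c"
      using le(2) by (auto simp: eventually_sequentially)
    have M: "(\<lambda>z. slope s (U n) z - slope s u z) \<in> borel_measurable ?P"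
      using slope_u sq(2)[of n] by (intro borel_measurable_diff) (auto simp: sq_integrable_def)
    show "sq_integrable ?P (\<lambda>z. slope s (U n) z - slope s u z)"
      "(LINT z|?P. (slope s (U n) z - slope s u z)\<^sup>2) \<le> (1/4) ^ n / c"
      by (rule integral_square_Fatou[OF F M L B])+
  qed
  have "AE x in lebesgue. x \<notin> \<Omega> \<longrightarrow> U n x = 0" for n
    using U by (simp add: H0s_iff)
  then have "AE x in lebesgue. \<forall>n. x \<notin> \<Omega> \<longrightarrow> U n x = 0"
    by (intro AE_all_countable[THEN iffD2] allI)
  with lim have "AE x in lebesgue. x \<notin> \<Omega> \<longrightarrow> u x = 0"
  proof eventually_elim
    case (elim x)
    show ?case
    proof
      assume "x \<notin> \<Omega>"
      then have "(\<lambda>n. U n x) = (\<lambda>n. 0)" using elim(2) by (intro ext) blast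
      with elim(1) show "u x = 0" by (simp only: LIMSEQ_const_iff)
    qed
  qed
  \<comment> \<open>The limit is recovered as \<open>U 0 - (U 0 - u)\<close>; the slope is treated
    likewise.\<close>
  moreover have "sq_integrable lebesgue u"
    using sq_integrable_diff[OF sq(1) diff(1), of 0 0] by simp
  moreover have "sq_integrable ?P (slope s u)"
    using sq_integrable_diff[OF sq(2) slope_diff'(1), of 0 0] by simp
  ultimately have u: "u \<in> H0s \<Omega> s" by (simp add: H0s_iff)
  \<comment> \<open>The factor 2 counts one \<open>(1/4) ^ n\<close> for each part of the
    norm.\<close>
  have rate: "(H0s_norm \<Omega> s (\<lambda>x. U n x - u x))\<^sup>2 \<le> 2 * (1/4) ^ n" for n
  proof -
    have "c * (LINT z|?P. (slope s (U n) z - slope s u z)\<^sup>2) \<le> (1/4) ^ n"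
      using slope_diff'(2)[of n] c by (simp add: pos_le_divide_eq mult.commute)
    then show ?thesis
      unfolding norm_eq[OF H0s_diff[OF U u]] slope_diff using diff(2)[of n] by linarith
  qed
  have geometric: "(\<lambda>n. 2 * (1/4::real) ^ n) \<longlonglongrightarrow> 0"
    by (intro tendsto_mult_right_zero LIMSEQ_power_zero) simp
  have "(\<lambda>n. (H0s_norm \<Omega> s (\<lambda>x. U n x - u x))\<^sup>2) \<longlonglongrightarrow> 0"
    by (rule tendsto_sandwich[OF always_eventually always_eventually tendsto_const geometric])
      (intro allI zero_le_power2 rate)+
  with u show ?thesis by blast
qed

section \<open>Convexity and continuity estimates for the Tikhonov functional\<close>

lemma bounded_linear_H0s_L2_lincomb:
  assumes "bounded_linear_H0s_L2 \<Omega> s K" "u \<in> H0s \<Omega> s" "v \<in> H0s \<Omega> s"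
  shows "AE x in lebesgue_on \<Omega>. K (\<lambda>t. a * u t + b * v t) x = a * K u x + b * K v x"
proof -
  have H: "(\<lambda>t. a * u t) \<in> H0s \<Omega> s" "(\<lambda>t. b * v t) \<in> H0s \<Omega> s"
    using H0s_lincomb[OF assms(2,2), of a 0] H0s_lincomb[OF assms(3,3), of b 0] by auto
  have "AE x in lebesgue_on \<Omega>. K (\<lambda>t. a * u t + b * v t) x = K (\<lambda>t. a * u t) x + K (\<lambda>t. b * v t) x"
    "AE x in lebesgue_on \<Omega>. K (\<lambda>t. a * u t) x = a * K u x"
    "AE x in lebesgue_on \<Omega>. K (\<lambda>t. b * v t) x = b * K v x"
    using assms H by (auto simp: bounded_linear_H0s_L2_def)
  then show ?thesis by eventually_elim simp
qed

text \<open>Both parts of the squared norm are integrated squares of expressions linear in the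
  function, so their parallelogram identities add up.\<close>

lemma H0s_norm_midpoint:
  fixes \<Omega> :: "(real ^ 'n) set"
  assumes "\<Omega> \<in> sets lebesgue" "0 < s" "s < 1" and uv: "u \<in> H0s \<Omega> s" "v \<in> H0s \<Omega> s"
  shows "(H0s_norm \<Omega> s (\<lambda>x. 1/2 * u x + 1/2 * v x))\<^sup>2 =
    ((H0s_norm \<Omega> s u)\<^sup>2 + (H0s_norm \<Omega> s v)\<^sup>2) / 2 - (H0s_norm \<Omega> s (\<lambda>x. u x - v x))\<^sup>2 / 4"
proof -
  note norm_eq = H0s_norm_square[OF assms(1-3)]
  have L2: "(LINT x|lebesgue. (1/2 * u x + 1/2 * v x)\<^sup>2) =
     ((LINT x|lebesgue. (u x)\<^sup>2) + (LINT x|lebesgue. (v x)\<^sup>2)) / 2 - (LINT x|lebesgue. (u x - v x)\<^sup>2) / 4"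
    using integral_square_midpoint[of lebesgue u v] uv by (simp add: H0s_iff add_divide_distrib)
  have seminorm: "(LINT z|(lebesgue \<Otimes>\<^sub>M lebesgue). (1/2 * slope s u z + 1/2 * slope s v z)\<^sup>2) =
     ((LINT z|(lebesgue \<Otimes>\<^sub>M lebesgue). (slope s u z)\<^sup>2) + (LINT z|(lebesgue \<Otimes>\<^sub>M lebesgue). (slope s v z)\<^sup>2)) / 2
      - (LINT z|(lebesgue \<Otimes>\<^sub>M lebesgue). (slope s u z - slope s v z)\<^sup>2) / 4"
    using integral_square_midpoint[of "lebesgue \<Otimes>\<^sub>M lebesgue" "slope s u" "slope s v"] uv
    by (simp add: H0s_iff add_divide_distrib)
  show ?thesis
    unfolding norm_eq[OF uv(1)] norm_eq[OF uv(2)] norm_eq[OF H0s_diff[OF uv]] norm_eq[OF H0s_lincomb[OF uv]]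
      slope_lincomb slope_diff L2 seminorm by (simp add: field_simps)
qed

lemma H0s_norm_weighted:
  fixes \<Omega> :: "(real ^ 'n) set"
  assumes "\<Omega> \<in> sets lebesgue" "0 < s" "s < 1" and uv: "u \<in> H0s \<Omega> s" "v \<in> H0s \<Omega> s" and "0 < t"
  shows "(H0s_norm \<Omega> s v)\<^sup>2 \<le>
    (1 + t) * (H0s_norm \<Omega> s u)\<^sup>2 + (1 + 1 / t) * (H0s_norm \<Omega> s (\<lambda>x. u x - v x))\<^sup>2"
proof -
  define c where "c = frac_laplacian_const CARD('n) s / 2"
  have c: "0 < c" using frac_laplacian_const_pos[OF assms(2,3)] by (simp add: c_def)
  note norm_eq = H0s_norm_square[OF assms(1-3), folded c_def]
  have "(LINT x|lebesgue. (v x)\<^sup>2) \<le>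
      (1 + t) * (LINT x|lebesgue. (u x)\<^sup>2) + (1 + 1 / t) * (LINT x|lebesgue. (u x - v x)\<^sup>2)"
    using uv \<open>0 < t\<close> by (intro integral_square_le_weighted) (auto simp: H0s_iff)
  moreover have "c * (LINT z|(lebesgue \<Otimes>\<^sub>M lebesgue). (slope s v z)\<^sup>2) \<le>
      c * ((1 + t) * (LINT z|(lebesgue \<Otimes>\<^sub>M lebesgue). (slope s u z)\<^sup>2)
        + (1 + 1 / t) * (LINT z|(lebesgue \<Otimes>\<^sub>M lebesgue). (slope s u z - slope s v z)\<^sup>2))"
    using uv \<open>0 < t\<close> c by (intro mult_left_mono integral_square_le_weighted) (auto simp: H0s_iff)
  ultimately show ?thesis
    unfolding norm_eq[OF uv(1)] norm_eq[OF uv(2)] norm_eq[OF H0s_diff[OF uv]] slope_diff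
    by (simp add: algebra_simps)
qed

text \<open>The data term is merely used as convex; the gain comes from the penalty, whose factor
  \<open>\<alpha> / 2\<close> times the 1/4 of the parallelogram identity gives
  \<open>\<alpha> / 8\<close>.\<close>

lemma tikhonov_midpoint:
  fixes \<Omega> :: "(real ^ 'n) set"
  assumes "\<Omega> \<in> sets lebesgue" "0 < s" "s < 1" and K: "bounded_linear_H0s_L2 \<Omega> s K"
    and y: "y \<in> L2 \<Omega>" and uv: "u \<in> H0s \<Omega> s" "v \<in> H0s \<Omega> s"
  shows "tikhonov \<Omega> s K y \<alpha> (\<lambda>x. 1/2 * u x + 1/2 * v x) \<le>
    (tikhonov \<Omega> s K y \<alpha> u + tikhonov \<Omega> s K y \<alpha> v) / 2
      - \<alpha> / 8 * (H0s_norm \<Omega> s (\<lambda>x. u x - v x))\<^sup>2"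
proof -
  let ?w = "\<lambda>x. 1/2 * u x + 1/2 * v x"
  have L2: "K u \<in> L2 \<Omega>" "K v \<in> L2 \<Omega>" "K ?w \<in> L2 \<Omega>"
    using K uv H0s_lincomb[OF uv] unfolding bounded_linear_H0s_L2_def by blast+
  then have [measurable]: "K u \<in> borel_measurable (lebesgue_on \<Omega>)" "K v \<in> borel_measurable (lebesgue_on \<Omega>)"
    "K ?w \<in> borel_measurable (lebesgue_on \<Omega>)" "y \<in> borel_measurable (lebesgue_on \<Omega>)"
    using y by (auto simp: L2_def)
  have sq: "sq_integrable (lebesgue_on \<Omega>) (\<lambda>x. K u x - y x)" "sq_integrable (lebesgue_on \<Omega>) (\<lambda>x. K v x - y x)"
    using L2 y by (auto intro!: sq_integrable_diff simp: L2_iff)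
  have "(L2_norm \<Omega> (\<lambda>x. K ?w x - y x))\<^sup>2 =
      (LINT x|lebesgue_on \<Omega>. (((K u x - y x) + (K v x - y x)) / 2)\<^sup>2)"
    unfolding L2_norm_square
  proof (rule integral_cong_AE)
    \<comment> \<open>\<open>K\<close> is linear only up to null sets, so the integrands agree
      almost everywhere; \<open>y\<close> is split into two halves.\<close>
    show "AE x in lebesgue_on \<Omega>. (K ?w x - y x)\<^sup>2 = (((K u x - y x) + (K v x - y x)) / 2)\<^sup>2"
      using bounded_linear_H0s_L2_lincomb[OF K uv, of "1/2" "1/2"]
    proof eventually_elim
      case (elim x)
      then have "K ?w x - y x = ((K u x - y x) + (K v x - y x)) / 2" by (simp add: field_simps)
      then show ?case by (simp only:)
    qed
  qed measurable
  also have "\<dots> \<le> ((L2_norm \<Omega> (\<lambda>x. K u x - y x))\<^sup>2 + (L2_norm \<Omega> (\<lambda>x. K v x - y x))\<^sup>2) / 2"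
  proof -
    have "0 \<le> (LINT x|lebesgue_on \<Omega>. ((K u x - y x) - (K v x - y x))\<^sup>2)" by simp
    then show ?thesis unfolding integral_square_midpoint[OF sq] L2_norm_square by linarith
  qed
  finally show ?thesis
    unfolding tikhonov_def H0s_norm_midpoint[OF assms(1-3) uv] by (simp add: field_simps)
qed

text \<open>The residuals of \<open>u\<close> and \<open>v\<close> differ by
  \<open>K (u - v)\<close> almost everywhere, so the operator bound contributes
  \<open>B\<^sup>2\<close> and the penalty contributes \<open>\<alpha>\<close> to the
  constant.\<close>

lemma tikhonov_weighted:
  fixes \<Omega> :: "(real ^ 'n) set"
  assumes "\<Omega> \<in> sets lebesgue" "0 < s" "s < 1" and K: "bounded_linear_H0s_L2 \<Omega> s K"
    and B: "\<And>u. u \<in> H0s \<Omega> s \<Longrightarrow> L2_norm \<Omega> (K u) \<le> B * H0s_norm \<Omega> s u"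
    and y: "y \<in> L2 \<Omega>" and uv: "u \<in> H0s \<Omega> s" "v \<in> H0s \<Omega> s" and t: "0 < t" and \<alpha>: "0 < \<alpha>"
  shows "tikhonov \<Omega> s K y \<alpha> v \<le> (1 + t) * tikhonov \<Omega> s K y \<alpha> u
      + (1 + 1 / t) * ((B\<^sup>2 + \<alpha>) / 2 * (H0s_norm \<Omega> s (\<lambda>x. u x - v x))\<^sup>2)"
proof -
  let ?d = "\<lambda>x. u x - v x"
  have L2: "K u \<in> L2 \<Omega>" "K v \<in> L2 \<Omega>" "K ?d \<in> L2 \<Omega>"
    using K uv H0s_diff[OF uv] unfolding bounded_linear_H0s_L2_def by blast+
  then have [measurable]: "K u \<in> borel_measurable (lebesgue_on \<Omega>)" "K v \<in> borel_measurable (lebesgue_on \<Omega>)"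
    "K ?d \<in> borel_measurable (lebesgue_on \<Omega>)" "y \<in> borel_measurable (lebesgue_on \<Omega>)"
    using y by (auto simp: L2_def)
  have sq: "sq_integrable (lebesgue_on \<Omega>) (\<lambda>x. K u x - y x)" "sq_integrable (lebesgue_on \<Omega>) (\<lambda>x. K v x - y x)"
    using L2 y by (auto intro!: sq_integrable_diff simp: L2_iff)
  have "(LINT x|lebesgue_on \<Omega>. ((K u x - y x) - (K v x - y x))\<^sup>2) = (L2_norm \<Omega> (K ?d))\<^sup>2"
    unfolding L2_norm_square
  proof (rule integral_cong_AE)
    show "AE x in lebesgue_on \<Omega>. ((K u x - y x) - (K v x - y x))\<^sup>2 = (K ?d x)\<^sup>2"
      using bounded_linear_H0s_L2_lincomb[OF K uv, of 1 "- 1"] by eventually_elim simp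
  qed measurable
  also have "\<dots> \<le> (B * H0s_norm \<Omega> s ?d)\<^sup>2"
    using B[OF H0s_diff[OF uv]] by (intro power_mono) (auto simp: L2_norm_def)
  finally have "(1 + 1 / t) * (LINT x|lebesgue_on \<Omega>. ((K u x - y x) - (K v x - y x))\<^sup>2)
      \<le> (1 + 1 / t) * (B\<^sup>2 * (H0s_norm \<Omega> s ?d)\<^sup>2)"
    using t by (intro mult_left_mono) (auto simp: power_mult_distrib)
  then have le: "(L2_norm \<Omega> (\<lambda>x. K v x - y x))\<^sup>2 \<le> (1 + t) * (L2_norm \<Omega> (\<lambda>x. K u x - y x))\<^sup>2
      + (1 + 1 / t) * (B\<^sup>2 * (H0s_norm \<Omega> s ?d)\<^sup>2)"
    using integral_square_le_weighted[OF sq t] unfolding L2_norm_square by linarith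
  \<comment> \<open>Stated for arbitrary reals so that norms and weights enter the algebra as
    atoms.\<close>
  have rearrange: "1 / 2 * (a * p + b * (B\<^sup>2 * r)) + \<alpha> / 2 * (a * q + b * r) =
      a * (1 / 2 * p + \<alpha> / 2 * q) + b * ((B\<^sup>2 + \<alpha>) / 2 * r)" for a b p q r :: real
    by (simp add: field_simps)
  have "tikhonov \<Omega> s K y \<alpha> v \<le>
      1 / 2 * ((1 + t) * (L2_norm \<Omega> (\<lambda>x. K u x - y x))\<^sup>2 + (1 + 1 / t) * (B\<^sup>2 * (H0s_norm \<Omega> s ?d)\<^sup>2))
      + \<alpha> / 2 * ((1 + t) * (H0s_norm \<Omega> s u)\<^sup>2 + (1 + 1 / t) * (H0s_norm \<Omega> s ?d)\<^sup>2)"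
    unfolding tikhonov_def using \<alpha>
    by (intro add_mono mult_left_mono le H0s_norm_weighted[OF assms(1-3) uv t]) simp_all
  also have "\<dots> = (1 + t) * tikhonov \<Omega> s K y \<alpha> u
      + (1 + 1 / t) * ((B\<^sup>2 + \<alpha>) / 2 * (H0s_norm \<Omega> s ?d)\<^sup>2)"
    unfolding tikhonov_def by (rule rearrange)
  finally show ?thesis .
qed

text \<open>Both parts of the squared norm are nonnegative, so the L2 part vanishes; being an
  integral over the whole space, it yields equality there and not just on
  \<open>\<Omega>\<close>.\<close>

lemma AE_eq_if_H0s_norm_diff_nonpos:
  fixes \<Omega> :: "(real ^ 'n) set"
  assumes "\<Omega> \<in> sets lebesgue" and s: "0 < s" "s < 1" and uv: "u \<in> H0s \<Omega> s" "v \<in> H0s \<Omega> s"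
    and le: "(H0s_norm \<Omega> s (\<lambda>x. u x - v x))\<^sup>2 \<le> 0"
  shows "AE x in lebesgue. u x = v x"
proof -
  have "0 \<le> frac_laplacian_const CARD('n) s / 2 *
      (LINT z|(lebesgue \<Otimes>\<^sub>M lebesgue). (slope s (\<lambda>x. u x - v x) z)\<^sup>2)"
    using frac_laplacian_const_pos[OF s, of "CARD('n)"] by simp
  moreover have "0 \<le> (LINT x|lebesgue. (u x - v x)\<^sup>2)" by simp
  ultimately have "(LINT x|lebesgue. (u x - v x)\<^sup>2) = 0"
    using le H0s_norm_square[OF assms(1-3) H0s_diff[OF uv]] by linarith
  moreover have "integrable lebesgue (\<lambda>x. (u x - v x)\<^sup>2)"
    using H0s_diff[OF uv] by (simp add: H0s_iff sq_integrable_def)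
  ultimately show ?thesis by (subst (asm) integral_nonneg_eq_0_iff_AE) auto
qed

section \<open>Existence and almost everywhere uniqueness of the minimizer\<close>

theorem theorem2p2:
  fixes \<Omega> :: "(real ^ 'n) set"
    and s :: real
    and K :: "(real ^ 'n \<Rightarrow> real) \<Rightarrow> real ^ 'n \<Rightarrow> real"
  assumes "bounded_lipschitz_domain \<Omega>"
    and "0 < s" and "s < 1"
    and "bounded_linear_H0s_L2 \<Omega> s K"
  shows "\<forall>\<alpha> > 0. \<forall>y\<delta> \<in> L2 \<Omega>.
           \<exists>u. is_minimizer_on (tikhonov \<Omega> s K y\<delta> \<alpha>) (H0s \<Omega> s) u \<and>
               (\<forall>v. is_minimizer_on (tikhonov \<Omega> s K y\<delta> \<alpha>) (H0s \<Omega> s) v \<longrightarrow>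
                    (AE x in lebesgue. v x = u x))"
proof (intro allI impI ballI)
  fix \<alpha> :: real and y assume \<alpha>: "0 < \<alpha>" and y: "y \<in> L2 \<Omega>"
  have \<Omega>: "\<Omega> \<in> sets lebesgue"
    using assms(1) by (auto simp: bounded_lipschitz_domain_def)
  obtain B where B: "\<And>u. u \<in> H0s \<Omega> s \<Longrightarrow> L2_norm \<Omega> (K u) \<le> B * H0s_norm \<Omega> s u"
    using assms(4) unfolding bounded_linear_H0s_L2_def by blast
  let ?J = "tikhonov \<Omega> s K y \<alpha>" and ?d = "\<lambda>u v. (H0s_norm \<Omega> s (\<lambda>x. u x - v x))\<^sup>2"
  have "(\<lambda>x. 0) \<in> H0s \<Omega> s" by (simp add: H0s_iff sq_integrable_def slope_def[abs_def])
  then have ne: "H0s \<Omega> s \<noteq> {}" by blast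
  have nonneg: "0 \<le> ?J u" if "u \<in> H0s \<Omega> s" for u using \<alpha> by (simp add: tikhonov_def)
  have mid: "\<exists>w\<in>H0s \<Omega> s. ?J w \<le> (?J u + ?J v) / 2 - \<alpha> / 8 * ?d u v"
    if "u \<in> H0s \<Omega> s" "v \<in> H0s \<Omega> s" for u v
    using tikhonov_midpoint[OF \<Omega> assms(2-4) y that] H0s_lincomb[OF that] by blast
  have upper: "?J v \<le> (1 + t) * ?J u + (1 + 1 / t) * ((B\<^sup>2 + \<alpha>) / 2 * ?d u v)"
    if "u \<in> H0s \<Omega> s" "v \<in> H0s \<Omega> s" "0 < t" for u v t
    by (rule tikhonov_weighted[OF \<Omega> assms(2-4) B y that \<alpha>])
  have complete: "\<exists>u\<in>H0s \<Omega> s. (\<lambda>n. ?d (U n) u) \<longlonglongrightarrow> 0"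
    if "range U \<subseteq> H0s \<Omega> s" "\<And>n k. n \<le> k \<Longrightarrow> ?d (U n) (U k) \<le> (1/4) ^ n" for U
    using that by (intro H0s_complete[OF \<Omega> assms(2,3)]) auto
  have pos: "0 < \<alpha> / 8" using \<alpha> by simp
  \<comment> \<open>The constant \<open>c\<close> is the midpoint gain of
    \<open>tikhonov_midpoint\<close>, and \<open>C\<close> is the constant of
    \<open>tikhonov_weighted\<close>.\<close>
  have "\<exists>u. is_minimizer_on ?J (H0s \<Omega> s) u"
    by (rule strongly_convex_minimizer(1)[where d = ?d and c = "\<alpha> / 8" and C = "(B\<^sup>2 + \<alpha>) / 2"]) (fact ne nonneg pos mid upper complete)+
  then obtain u where u: "is_minimizer_on ?J (H0s \<Omega> s) u" by blast
  have unique: "?d v w \<le> 0" if "is_minimizer_on ?J (H0s \<Omega> s) v" "is_minimizer_on ?J (H0s \<Omega> s) w" for v w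
    by (rule strongly_convex_minimizer(2)[where d = ?d and c = "\<alpha> / 8" and C = "(B\<^sup>2 + \<alpha>) / 2", OF _ _ _ _ _ _ that])
      (fact ne nonneg pos mid upper complete)+
  note u
  moreover have "AE x in lebesgue. v x = u x" if v: "is_minimizer_on ?J (H0s \<Omega> s) v" for v
  proof (rule AE_eq_if_H0s_norm_diff_nonpos[OF \<Omega> assms(2,3) _ _ unique[OF v u]])
    show "v \<in> H0s \<Omega> s" "u \<in> H0s \<Omega> s" using u v unfolding is_minimizer_on_def by blast+
  qed
  ultimately show "\<exists>u. is_minimizer_on ?J (H0s \<Omega> s) u \<and>
      (\<forall>v. is_minimizer_on ?J (H0s \<Omega> s) v \<longrightarrow> (AE x in lebesgue. v x = u x))"
    by blast
qed

end
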